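(* If $T$ and $T'$ are trees of respective orders $n$ and $n'$, where $n'\geq n\geq 2$, then $$\nabla(T \,\square\, T')\geq n-1 = \nabla(T \,\square\, S_{n'}).$$
   Context: The order of a graph is its number of vertices. $S_n$ denotes the star $K_{1,n-1}$ on $n$ vertices. A decycling set of a graph $G$ is a set $S\subseteq V(G)$ such that the subgraph of $G$ induced by $V(G)\setminus S$ is a forest (contains no cycle). The decycling number $\nabla(G)$ is the minimum cardinality of a decycling set of $G$. The Cartesian product $G \,\square\, H$ has vertex set $V(G)\times V(H)$, and two vertices $(g,h)$ and $(g',h')$ are adjacent if either $g=g'$ and $hh'\in E(H)$, or $gg'\in E(G)$ and $h=h'$. *)

theory Defs
  imports "Graph_Theory.Graph_Theory"
begin

text \<open>
  A finite simple graph is a symmetric digraph as in the AFP entry \<open>Graph_Theory\<close>: every edge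
  is represented by its two opposite arcs.  The library's \<open>cycle\<close> (and hence its \<open>forest\<close>
  and \<open>tree\<close>) counts the closed walk \<open>a, b, a\<close> along a single edge as a cycle; in a simple
  graph the undirected cycles are exactly the cycles of length at least 3.
\<close>

definition undirected_forest :: "('a, 'b) pre_digraph \<Rightarrow> bool" where
  "undirected_forest G \<longleftrightarrow> graph G \<and> \<not> (\<exists>p. pre_digraph.cycle G p \<and> 3 \<le> length p)"

definition undirected_tree :: "('a, 'b) pre_digraph \<Rightarrow> bool" where
  "undirected_tree G \<longleftrightarrow> connected G \<and> undirected_forest G"

definition cartesian_product ::
    "'a pair_pre_digraph \<Rightarrow> 'b pair_pre_digraph \<Rightarrow> ('a \<times> 'b) pair_pre_digraph"
    (infixl \<open>\<box>\<close> 70) where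
  "G \<box> H = \<lparr> pverts = pverts G \<times> pverts H,
     parcs = {((g, h), (g', h')).
       (g \<in> pverts G \<and> g = g' \<and> (h, h') \<in> parcs H) \<or>
       ((g, g') \<in> parcs G \<and> h \<in> pverts H \<and> h = h')} \<rparr>"

definition decycling_set :: "('a, 'b) pre_digraph \<Rightarrow> 'a set \<Rightarrow> bool" where
  "decycling_set G S \<longleftrightarrow> S \<subseteq> verts G \<and> undirected_forest (G \<restriction> (verts G - S))"

definition decycling_number :: "('a, 'b) pre_digraph \<Rightarrow> nat" where
  "decycling_number G = (LEAST k. \<exists>S. finite S \<and> decycling_set G S \<and> card S = k)"

end

theory Submission
  imports Defs
begin

text \<open>
  In a product \<open>G \<box> H\<close> call the copies \<open>{g} \<times> H\<close> of \<open>H\<close> columns and the copies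
  \<open>G \<times> {h}\<close> of \<open>G\<close> rows.

  Lower bound: every vertex of a set \<open>S\<close> spoils one column and one row.  If \<open>card S\<close> is
  at most \<open>n - 2\<close>, where both factors have at least \<open>n\<close> vertices, then two columns
  \<open>g\<^sub>1, g\<^sub>2\<close> and two rows \<open>h\<^sub>1, h\<^sub>2\<close> avoid \<open>S\<close> altogether.  When the factors are
  connected, a path from \<open>g\<^sub>1\<close> to \<open>g\<^sub>2\<close> and a path from \<open>h\<^sub>1\<close> to \<open>h\<^sub>2\<close> form the
  sides of a closed rectangle inside these four fibres
  (\<open>cartesian_product_rectangle\<close>), and this rectangle is a cycle that avoids \<open>S\<close>.  So
  \<open>S\<close> is not a decycling set (\<open>decycling_set_cartesian_product_card\<close>).

  Upper bound for a star with hub \<open>c\<close>: delete every vertex of the row of \<open>c\<close> except one,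
  \<open>(g, c)\<close>.  What remains is one copy of the tree \<open>T\<close> for each leaf of the star, joined
  together only through \<open>(g, c)\<close>, which has exactly one neighbour \<open>(g, l)\<close> in each copy.
  A cycle through \<open>(g, c)\<close> would have to leave it into some copy and come back from the same
  copy, using the vertex \<open>(g, l)\<close> twice; a cycle that misses \<open>(g, c)\<close> would lie in a
  single copy of \<open>T\<close> (\<open>star_product_decycling_set\<close>).
\<close>

section \<open>Walks as lists of ordered pairs\<close>

lemma pcas_append:
  "pcas u (p @ q) v \<longleftrightarrow> (\<exists>w. pcas u p w \<and> pcas w q v)"
  by (induct p arbitrary: u) auto

lemma pcas_map:
  "pcas u p v \<Longrightarrow> pcas (f u) (map (map_prod f f) p) (f v)"
  by (induct p arbitrary: u) auto

lemma pcas_rev_path: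
  "pcas u p v \<Longrightarrow> pcas v (rev_path p) u"
  by (induct p arbitrary: u) (auto simp: pcas_append)

lemma map_snd_rev_path: "map snd (rev_path p) = rev (map fst p)"
  by (induct p) auto

lemma set_rev_path: "set (rev_path p) = prod.swap ` set p"
  by (induct p) (auto simp: prod.swap_def)

lemma pawalk_verts_eq_Cons: "pcas u p v \<Longrightarrow> pawalk_verts u p = u # map snd p"
  by (induct p arbitrary: u) auto

lemma pawalk_verts_eq_snoc: "pcas u p v \<Longrightarrow> pawalk_verts u p = map fst p @ [v]"
  by (induct p arbitrary: u) auto

lemma pcas_heads_tails: "pcas u p v \<Longrightarrow> insert v (fst ` set p) = insert u (snd ` set p)"
  by (induct p arbitrary: u) auto

lemma pcas_end_in_heads: "pcas u p v \<Longrightarrow> p \<noteq> [] \<Longrightarrow> v \<in> snd ` set p"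
  by (induct p arbitrary: u) fastforce+

text \<open>
  Used with the leaf coordinate as \<open>k\<close>: a walk all of whose arcs run inside copies of one
  factor never changes its copy.
\<close>

lemma pcas_invariant:
  assumes "pcas u p v" and "\<And>a b. (a, b) \<in> set p \<Longrightarrow> k a = k b"
  shows "k v = k u" and "\<And>e. e \<in> set p \<Longrightarrow> k (snd e) = k u"
proof -
  have "k v = k u \<and> (\<forall>e\<in>set p. k (snd e) = k u)"
    using assms
  proof (induct p arbitrary: u)
    case (Cons e p)
    then have "k (snd e) = k u" by (metis list.set_intros(1) pcas.simps(2) prod.collapse)
    moreover have "k v = k (snd e) \<and> (\<forall>e'\<in>set p. k (snd e') = k (snd e))"
      using Cons by auto
    ultimately show ?case by auto
  qed auto
  then show "k v = k u" and "\<And>e. e \<in> set p \<Longrightarrow> k (snd e) = k u" by auto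
qed

lemma closed_pcas_rotate:
  assumes "pcas u (q @ r) u"
  shows "\<exists>w. pcas w (r @ q) w"
  using assms by (auto simp: pcas_append)

text \<open>
  On a closed walk the vertices without the first one are the heads of the arcs.  Phrased with
  heads, the condition on a cycle no longer mentions its starting point, so it survives
  rotation, and it is easy to push through products and projections.
\<close>

lemma cycle_pairs_iff:
  assumes "wf_digraph H" and [simp]: "tail H = fst" "head H = snd"
  shows "pre_digraph.cycle H p \<longleftrightarrow>
    p \<noteq> [] \<and> set p \<subseteq> arcs H \<and> distinct (map snd p) \<and> (\<exists>u. pcas u p u)"
proof -
  interpret wf_digraph H by fact
  have [simp]: "cas u p v = pcas u p v" for u v p
    by (induct p arbitrary: u) auto
  have verts: "awalk_verts u p = u # map snd p" if "pcas u p v" for u v p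
    using that by (induct p arbitrary: u) auto
  have "u \<in> verts H" if "pcas u p v" "p \<noteq> []" "set p \<subseteq> arcs H" for u v
    using that tail_in_verts by (cases p) auto
  then have "awalk u p u \<and> distinct (tl (awalk_verts u p)) \<and> p \<noteq> [] \<longleftrightarrow>
      p \<noteq> [] \<and> set p \<subseteq> arcs H \<and> distinct (map snd p) \<and> pcas u p u" for u
    by (auto simp: awalk_def verts)
  then show ?thesis
    unfolding cycle_def by blast
qed

lemma (in pair_graph) connected_path:
  assumes "connected (with_proj G)" "u \<in> pverts G" "v \<in> pverts G" "u \<noteq> v"
  obtains p where "p \<noteq> []" "set p \<subseteq> parcs G" "pcas u p v"
    "distinct (map fst p)" "distinct (map snd p)"
    "u \<notin> snd ` set p" "v \<notin> fst ` set p"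
proof -
  have "u \<rightarrow>\<^sup>*\<^bsub>with_proj G\<^esub> v"
    using assms symmetric_connected_imp_strongly_connected[OF sym_arcs]
    by (auto simp: strongly_connected_def)
  then obtain p where "apath u p v"
    using reachable_apath by blast
  then have p: "set p \<subseteq> parcs G" "pcas u p v" "distinct (pawalk_verts u p)"
    by (auto simp: apath_def awalk_def)
  from p(3) have "distinct (u # map snd p)" "distinct (map fst p @ [v])"
    using pawalk_verts_eq_Cons[OF p(2)] pawalk_verts_eq_snoc[OF p(2)] by metis+
  moreover have "p \<noteq> []" using p(2) assms(4) by auto
  ultimately show thesis using that p by auto
qed

section \<open>Induced subgraphs of Cartesian products\<close>

lemma pair_graph_cartesian_product:
  assumes "pair_graph G" and "pair_graph H"
  shows "pair_graph (G \<box> H)"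
proof -
  interpret G: pair_graph G by fact
  interpret H: pair_graph H by fact
  have "parcs (G \<box> H) \<subseteq> pverts (G \<box> H) \<times> pverts (G \<box> H)"
    by (auto simp: cartesian_product_def dest: G.wellformed' H.wellformed')
  moreover have fin: "finite (pverts (G \<box> H))"
    by (simp add: cartesian_product_def)
  ultimately have "finite (parcs (G \<box> H))"
    using finite_subset by blast
  moreover have "sym (parcs (G \<box> H))"
    by (rule symI) (auto simp: cartesian_product_def dest: G.arcs_symmetric H.arcs_symmetric)
  ultimately show ?thesis
    using fin by unfold_locales (auto simp: cartesian_product_def symmetric_def
        dest: G.wellformed' H.wellformed' G.no_loops' H.no_loops')
qed

lemma (in pair_graph) graph_induced:
  assumes "X \<subseteq> pverts G"
  shows "graph (with_proj G \<restriction> X)"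
proof -
  have ind: "induced_subgraph (with_proj G \<restriction> X) (with_proj G)"
    using assms by (intro induced_induce) simp
  interpret D: digraph "with_proj G \<restriction> X"
    using digraph_subgraph[OF induced_imp_subgraph[OF ind]] .
  show ?thesis
    using induced_graph_imp_symmetric[OF sym_arcs ind] by (rule D.graphI)
qed

text \<open>
  An induced subgraph of a simple graph is again a simple graph, so being a decycling set is
  only a matter of cycles.
\<close>

lemma (in pair_graph) decycling_set_iff:
  "decycling_set (with_proj G) S \<longleftrightarrow> S \<subseteq> pverts G \<and>
     \<not> (\<exists>p. 3 \<le> length p \<and> set p \<subseteq> parcs G \<inter> (pverts G - S) \<times> (pverts G - S) \<and>
       distinct (map snd p) \<and> (\<exists>u. pcas u p u))"
proof -
  have "graph (with_proj G \<restriction> (pverts G - S))"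
    by (rule graph_induced) auto
  moreover have "pre_digraph.cycle (with_proj G \<restriction> (pverts G - S)) p \<longleftrightarrow>
      p \<noteq> [] \<and> set p \<subseteq> parcs G \<inter> (pverts G - S) \<times> (pverts G - S) \<and>
      distinct (map snd p) \<and> (\<exists>u. pcas u p u)" for p
    by (subst cycle_pairs_iff) auto
  ultimately show ?thesis
    by (auto simp: decycling_set_def undirected_forest_def)
qed

section \<open>The lower bound\<close>

text \<open>
  With a path \<open>p\<close> from \<open>g\<^sub>1\<close> to \<open>g\<^sub>2\<close> and a path \<open>q\<close> from \<open>h\<^sub>1\<close> to
  \<open>h\<^sub>2\<close>, go along \<open>p\<close> in row \<open>h\<^sub>1\<close>, along \<open>q\<close> in column \<open>g\<^sub>2\<close>, back along
  \<open>p\<close> in row \<open>h\<^sub>2\<close> and back along \<open>q\<close> in column \<open>g\<^sub>1\<close>.  Two sides could share a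
  head only at a corner, and each corner is the head of the arc entering it and of no other,
  because the paths do not revisit their ends.
\<close>

lemma cartesian_product_rectangle:
  assumes "pair_graph G" "pair_graph H"
    and "connected (with_proj G)" "connected (with_proj H)"
    and g: "g\<^sub>1 \<in> pverts G" "g\<^sub>2 \<in> pverts G" "g\<^sub>1 \<noteq> g\<^sub>2"
    and h: "h\<^sub>1 \<in> pverts H" "h\<^sub>2 \<in> pverts H" "h\<^sub>1 \<noteq> h\<^sub>2"
  obtains u p where "3 \<le> length p" "distinct (map snd p)" "pcas u p u"
    "set p \<subseteq> parcs (G \<box> H)"
    "\<And>x y. (x, y) \<in> set p \<Longrightarrow>
       {x, y} \<subseteq> {g\<^sub>1, g\<^sub>2} \<times> pverts H \<union> pverts G \<times> {h\<^sub>1, h\<^sub>2}"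
proof -
  interpret G: pair_graph G by fact
  interpret H: pair_graph H by fact
  obtain p where p: "p \<noteq> []" "set p \<subseteq> parcs G" "pcas g\<^sub>1 p g\<^sub>2"
    "distinct (map fst p)" "distinct (map snd p)" "g\<^sub>1 \<notin> snd ` set p" "g\<^sub>2 \<notin> fst ` set p"
    using G.connected_path assms by metis
  obtain q where q: "q \<noteq> []" "set q \<subseteq> parcs H" "pcas h\<^sub>1 q h\<^sub>2"
    "distinct (map fst q)" "distinct (map snd q)" "h\<^sub>1 \<notin> snd ` set q" "h\<^sub>2 \<notin> fst ` set q"
    using H.connected_path assms by metis
  define row where "row h = map (map_prod (\<lambda>x::'a. (x, h::'b)) (\<lambda>x::'a. (x, h)))" for h
  define col where "col g = map (map_prod (\<lambda>y::'b. (g::'a, y)) (\<lambda>y::'b. (g, y)))" for g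
  note defs = row_def col_def
  let ?c = "row h\<^sub>1 p @ col g\<^sub>2 q @ row h\<^sub>2 (rev_path p) @ col g\<^sub>1 (rev_path q)"
  have snd_row: "map snd (row h r) = map (\<lambda>x. (x, h)) (map snd r)" for h r
    by (simp add: row_def)
  have snd_col: "map snd (col g r) = map (\<lambda>y. (g, y)) (map snd r)" for g r
    by (simp add: col_def)
  have "pcas (g\<^sub>1, h\<^sub>1) (row h\<^sub>1 p) (g\<^sub>2, h\<^sub>1)"
    unfolding row_def by (rule pcas_map[OF p(3)])
  moreover have "pcas (g\<^sub>2, h\<^sub>1) (col g\<^sub>2 q) (g\<^sub>2, h\<^sub>2)"
    unfolding col_def by (rule pcas_map[OF q(3)])
  moreover have "pcas (g\<^sub>2, h\<^sub>2) (row h\<^sub>2 (rev_path p)) (g\<^sub>1, h\<^sub>2)"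
    unfolding row_def by (rule pcas_map[OF pcas_rev_path[OF p(3)]])
  moreover have "pcas (g\<^sub>1, h\<^sub>2) (col g\<^sub>1 (rev_path q)) (g\<^sub>1, h\<^sub>1)"
    unfolding col_def by (rule pcas_map[OF pcas_rev_path[OF q(3)]])
  ultimately have closed: "pcas (g\<^sub>1, h\<^sub>1) ?c (g\<^sub>1, h\<^sub>1)"
    unfolding pcas_append by blast
  have ends: "set p \<subseteq> pverts G \<times> pverts G" "set q \<subseteq> pverts H \<times> pverts H"
    using p(2) q(2) by (auto dest!: subsetD dest: G.wellformed' H.wellformed')
  have inj: "inj_on (\<lambda>x. (x, h)) A" "inj_on (\<lambda>y. (g, y)) B"
    for h :: 'b and g :: 'a and A B
    by (auto simp: inj_on_def)
  have dist: "distinct (map snd ?c)"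
    unfolding map_append snd_row snd_col map_snd_rev_path
    using p(4-7) q(4-7) g(3) h(3)
    by (auto simp: distinct_map[of "\<lambda>x. (x, _)"] distinct_map[of "\<lambda>y. (_, y)"] inj
        simp del: map_map)
  have len: "3 \<le> length ?c"
    using p(1) q(1) by (cases p; cases q) (auto simp: defs)
  have arcs: "set ?c \<subseteq> parcs (G \<box> H)"
    using p(2) q(2) g h
    by (auto simp: defs cartesian_product_def set_rev_path
        dest: G.arcs_symmetric H.arcs_symmetric)
  have on: "{x, y} \<subseteq> {g\<^sub>1, g\<^sub>2} \<times> pverts H \<union> pverts G \<times> {h\<^sub>1, h\<^sub>2}"
    if "(x, y) \<in> set ?c" for x y
    using that ends by (auto simp: defs set_rev_path)
  show thesis by (rule that[OF len dist closed arcs on])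
qed

text \<open>
  Pigeonhole: the projections of \<open>S\<close> to the two factors have at most \<open>card S\<close> elements,
  so if \<open>card S \<le> k - 2\<close> each of them misses two vertices; the rectangle over these avoids
  \<open>S\<close>.
\<close>

lemma decycling_set_cartesian_product_card:
  assumes "pair_graph G" "pair_graph H"
    and "connected (with_proj G)" "connected (with_proj H)"
    and "k \<le> card (pverts G)" "k \<le> card (pverts H)"
    and S: "decycling_set (with_proj (G \<box> H)) S"
  shows "k - 1 \<le> card S"
proof (rule ccontr)
  interpret G: pair_graph G by fact
  interpret H: pair_graph H by fact
  interpret GH: pair_graph "G \<box> H"
    using assms by (intro pair_graph_cartesian_product)
  assume "\<not> k - 1 \<le> card S"
  then have small: "card S + 2 \<le> k" by simp
  have sub: "S \<subseteq> pverts (G \<box> H)" using S by (simp add: GH.decycling_set_iff)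
  then have fin: "finite S" using finite_subset by fastforce
  have two: "\<exists>x y. {x, y} \<subseteq> A - B \<and> x \<noteq> y"
    if "finite A" "finite B" "card B \<le> card S" "k \<le> card A" for A B :: "'c set"
  proof -
    have "2 \<le> card (A - B)"
      using diff_card_le_card_Diff[OF that(2), of A] that small by linarith
    then obtain C where "C \<subseteq> A - B" "card C = 2"
      using obtain_subset_with_card_n by metis
    then show ?thesis by (auto simp: card_2_iff)
  qed
  obtain g\<^sub>1 g\<^sub>2 where g: "{g\<^sub>1, g\<^sub>2} \<subseteq> pverts G - fst ` S" "g\<^sub>1 \<noteq> g\<^sub>2"
    using two[of "pverts G" "fst ` S"] card_image_le[OF fin] assms fin by auto
  obtain h\<^sub>1 h\<^sub>2 where h: "{h\<^sub>1, h\<^sub>2} \<subseteq> pverts H - snd ` S" "h\<^sub>1 \<noteq> h\<^sub>2"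
    using two[of "pverts H" "snd ` S"] card_image_le[OF fin] assms fin by auto
  obtain u p where p: "3 \<le> length p" "distinct (map snd p)" "pcas u p u"
    "set p \<subseteq> parcs (G \<box> H)"
    and on: "\<And>x y. (x, y) \<in> set p \<Longrightarrow>
       {x, y} \<subseteq> {g\<^sub>1, g\<^sub>2} \<times> pverts H \<union> pverts G \<times> {h\<^sub>1, h\<^sub>2}"
    by (rule cartesian_product_rectangle[OF assms(1-4), of g\<^sub>1 g\<^sub>2 h\<^sub>1 h\<^sub>2]) (use g h in auto)
  have "{g\<^sub>1, g\<^sub>2} \<times> pverts H \<union> pverts G \<times> {h\<^sub>1, h\<^sub>2} \<subseteq> pverts (G \<box> H) - S"
    using g h by (force simp: cartesian_product_def)
  then have "set p \<subseteq> (pverts (G \<box> H) - S) \<times> (pverts (G \<box> H) - S)"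
    using on by fast
  with p S show False unfolding GH.decycling_set_iff by (metis le_inf_iff)
qed

text \<open>
  The least element in the definition of the decycling number is attained, since the whole
  vertex set is a decycling set; without such a witness the value would be unspecified.
\<close>

lemma (in pair_graph) decycling_number_geI:
  assumes "\<And>S. decycling_set (with_proj G) S \<Longrightarrow> k \<le> card S"
  shows "k \<le> decycling_number (with_proj G)"
proof -
  have "p = []" if "set p \<subseteq> parcs G \<inter> (pverts G - pverts G) \<times> (pverts G - pverts G)" for p
    using that by simp
  then have "decycling_set (with_proj G) (pverts G)"
    unfolding decycling_set_iff by (metis list.size(3) not_numeral_le_zero order_refl)
  then have "\<exists>S. finite S \<and> decycling_set (with_proj G) S \<and> card S = card (pverts G)"
    using finite_verts by blast
  then have "\<exists>S. finite S \<and> decycling_set (with_proj G) S \<and>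
      card S = decycling_number (with_proj G)"
    unfolding decycling_number_def by (rule LeastI)
  then show ?thesis using assms by metis
qed

section \<open>The star attains the bound\<close>

lemma star_connected:
  assumes "pair_graph S" and "pverts S = insert c V"
    and "parcs S = {c} \<times> V \<union> V \<times> {c}"
  shows "connected (with_proj S)"
proof -
  interpret pair_graph S by fact
  have to: "u \<rightarrow>\<^sup>*\<^bsub>with_proj S\<^esub> c" and fro: "c \<rightarrow>\<^sup>*\<^bsub>with_proj S\<^esub> u"
    if "u \<in> pverts S" for u
    using that assms by (cases "u = c"; auto)+
  show ?thesis
    using reachable_mk_symmetricI reachable_trans[OF to fro] assms(2)
    by (intro connectedI) auto
qed

text \<open>
  The remaining graph consists of the copies \<open>T \<times> {l}\<close> for the leaves \<open>l\<close> and of the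
  vertex \<open>(g, c)\<close>, which is adjacent exactly to the vertices \<open>(g, l)\<close>.
\<close>

lemma star_product_decycling_set:
  assumes "pair_graph T" "pair_graph S"
    and forest: "undirected_forest (with_proj T)"
    and verts: "pverts S = insert c V" "c \<notin> V"
    and arcs: "parcs S = {c} \<times> V \<union> V \<times> {c}"
    and "g \<in> pverts T"
  shows "decycling_set (with_proj (T \<box> S)) ((pverts T - {g}) \<times> {c})"
proof -
  interpret T: pair_graph T by fact
  interpret S: pair_graph S by fact
  interpret TS: pair_graph "T \<box> S"
    using assms by (intro pair_graph_cartesian_product)
  let ?X = "pverts (T \<box> S) - (pverts T - {g}) \<times> {c}"
  define E where "E = parcs (T \<box> S) \<inter> ?X \<times> ?X"
  have at_hub: "b = g \<and> l \<in> V" if "((g, c), (b, l)) \<in> E \<or> ((b, l), (g, c)) \<in> E" for b l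
    using that verts(2) by (auto simp: E_def cartesian_product_def arcs dest: T.no_loops')
  have no_loop: "((g, c), (g, c)) \<notin> E"
    using verts(2) by (auto simp: E_def cartesian_product_def arcs dest: T.no_loops')
  have off_hub: "(fst x, fst y) \<in> parcs T \<and> snd x = snd y"
    if "(x, y) \<in> E" "x \<noteq> (g, c)" "y \<noteq> (g, c)" for x y
    using that by (auto simp: E_def cartesian_product_def arcs)
  have False if len: "3 \<le> length p" and A: "set p \<subseteq> E"
    and dist: "distinct (map snd p)" and closed: "pcas u p u" for p u
  proof (cases "(g, c) \<in> fst ` set p")
    case True
    \<comment> \<open>Rotate the cycle to start at \<open>(g, c)\<close>; let \<open>(b, l)\<close> be its next vertex and
      \<open>(b', l')\<close> its last one before the return.\<close>
    then obtain q e r where p: "p = q @ e # r" and e: "fst e = (g, c)"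
      by (metis imageE split_list)
    then obtain b l where e: "e = ((g, c), (b, l))"
      by (metis prod.collapse)
    obtain w where w: "pcas w ((e # r) @ q) w"
      using closed_pcas_rotate[OF closed[unfolded p]] by (rule exE)
    define r' where "r' = r @ q"
    have r': "set (((g, c), (b, l)) # r') = set p" "length r' = length p - 1"
        "distinct ((b, l) # map snd r')" "pcas (b, l) r' (g, c)"
      using dist w by (auto simp: p e r'_def)
    have "2 \<le> length r'" using r'(2) len by simp
    then obtain m f where m: "r' = m @ [f]" "m \<noteq> []"
      by (cases r' rule: rev_cases) (auto simp: Suc_le_eq)
    from m r'(4) have "pcas (b, l) m (fst f)" "snd f = (g, c)"
      unfolding pcas_append by auto
    then obtain b' l' where f: "f = ((b', l'), (g, c))" and walk: "pcas (b, l) m (b', l')"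
      by (metis prod.collapse)
    have in_E: "((g, c), (b, l)) \<in> E" "((b', l'), (g, c)) \<in> E" "set m \<subseteq> E"
      using A unfolding r'(1)[symmetric] m f by auto
    have bl: "(b, l) \<noteq> (g, c)"
      using in_E(1) no_loop by auto
    have ends: "b = g" "b' = g"
      using at_hub in_E by auto
    have no_head: "(g, c) \<notin> snd ` set m" using r'(3) m f by auto
    then have no_tail: "(g, c) \<notin> fst ` set m"
      using pcas_heads_tails[OF walk] bl by (metis insert_iff)
    have "snd x = snd y" if xy: "(x, y) \<in> set m" for x y
    proof -
      have "x \<noteq> (g, c)" "y \<noteq> (g, c)"
        using xy no_head no_tail by force+
      then show ?thesis using off_hub xy in_E(3) by blast
    qed
    then have "l' = l"
      using pcas_invariant(1)[OF walk, of snd] by simp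
    \<comment> \<open>So \<open>m\<close> is a closed walk from \<open>(g, l)\<close> to itself; it is not empty because the
      cycle has length at least 3, hence the cycle visits \<open>(g, l)\<close> twice.\<close>
    with ends walk have "(b, l) \<in> snd ` set m"
      using pcas_end_in_heads[OF walk m(2)] by simp
    with r'(3) m show False by auto
  next
    case False
    have ne: "p \<noteq> []" using len by auto
    have "u \<in> fst ` set p" using closed ne by (cases p) auto
    then have "fst ` set p = snd ` set p"
      using pcas_heads_tails[OF closed] pcas_end_in_heads[OF closed ne] by (simp add: insert_absorb)
    then have avoid: "x \<noteq> (g, c)" "y \<noteq> (g, c)" if "(x, y) \<in> set p" for x y
      using False that by force+
    have step: "(fst x, fst y) \<in> parcs T" "snd x = snd y" if "(x, y) \<in> set p" for x y
      using off_hub[of x y] avoid[OF that] that A by blast+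
    \<comment> \<open>The second coordinate is constant, so the projection to \<open>T\<close> stays a cycle.\<close>
    let ?p = "map (map_prod fst fst) p"
    have "snd z = snd u" if "z \<in> set (map snd p)" for z
      using that pcas_invariant(2)[where k = snd, OF closed step(2)] by auto
    then have "inj_on fst (set (map snd p))"
      by (intro inj_onI) (metis prod_eqI)
    then have "distinct (map fst (map snd p))"
      using dist by (simp only: distinct_map)
    then have "distinct (map snd ?p)"
      by (simp add: comp_def)
    moreover have "pcas (fst u) ?p (fst u)" by (rule pcas_map[OF closed])
    moreover have "set ?p \<subseteq> parcs T" using step(1) by auto
    ultimately have "T.cycle ?p"
      using ne by (subst cycle_pairs_iff) (auto simp: T.wf_digraph)
    then show False
      using forest len by (auto simp: undirected_forest_def)
  qed
  then show ?thesis
    unfolding TS.decycling_set_iff E_def[symmetric]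
    by (auto simp: cartesian_product_def verts(1))
qed

theorem theorem2p1:
  fixes T :: "'a pair_pre_digraph" and T' :: "'b pair_pre_digraph" and n n' :: nat
  assumes "undirected_tree (with_proj T)" and "undirected_tree (with_proj T')"
    and "card (pverts T) = n" and "card (pverts T') = n'"
    and "n \<ge> 2" and "n' \<ge> n"
  shows "decycling_number (with_proj (T \<box> T')) \<ge> n - 1 \<and>
    (\<forall>S :: 'c pair_pre_digraph. K\<^bsub>1,n'-1\<^esub> (with_proj S) \<longrightarrow>
       n - 1 = decycling_number (with_proj (T \<box> S)))"
proof -
  have T: "pair_graph T" "connected (with_proj T)" "undirected_forest (with_proj T)"
    and T': "pair_graph T'" "connected (with_proj T')"
    using assms(1,2) pair_graphI_graph by (auto simp: undirected_tree_def undirected_forest_def)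
  have lower: "n - 1 \<le> decycling_number (with_proj (T \<box> H))"
    if "pair_graph H" "connected (with_proj H)" "n \<le> card (pverts H)"
    for H :: "'d pair_pre_digraph"
    using T that assms(3)
    by (intro pair_graph.decycling_number_geI pair_graph_cartesian_product
        decycling_set_cartesian_product_card[of T H]) auto
  have "n - 1 = decycling_number (with_proj (T \<box> S))"
    if star: "K\<^bsub>1,n'-1\<^esub> (with_proj S)" for S :: "'c pair_pre_digraph"
  proof -
    have S: "pair_graph S" using star by (rule pair_graphI_complete_bipartite)
    obtain U V where UV: "finite (pverts S)" "pverts S = U \<union> V" "U \<inter> V = {}"
      "card U = 1" "card V = n' - 1" "parcs S = U \<times> V \<union> V \<times> U"
      using star unfolding complete_bipartite_digraph_pair_def by blast
    then obtain c where c: "U = {c}" by (auto simp: card_1_singleton_iff)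
    have "card (pverts S) = n'"
      using UV assms(5,6) by (simp add: card_Un_disjoint)
    moreover have "connected (with_proj S)"
      using star_connected[OF S] UV(2,6) c by simp
    ultimately have ge: "n - 1 \<le> decycling_number (with_proj (T \<box> S))"
      using assms(6) by (intro lower[OF S]) auto
    obtain g where g: "g \<in> pverts T"
      using assms(3,5) by fastforce
    have "decycling_set (with_proj (T \<box> S)) ((pverts T - {g}) \<times> {c})"
      using star_product_decycling_set[OF T(1) S T(3) _ _ _ g] UV(2,3,6) c by simp
    moreover have "finite (pverts T)" using assms(3,5) card.infinite by fastforce
    ultimately have "decycling_number (with_proj (T \<box> S)) \<le> n - 1"
      unfolding decycling_number_def using g assms(3)
      by (intro Least_le exI[of _ "(pverts T - {g}) \<times> {c}"]) (simp add: card_cartesian_product)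
    with ge show ?thesis by simp
  qed
  then show ?thesis
    using lower[OF T'] assms(4,6) by simp
qed

end
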